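(* Let $\alpha\in(0,\infty)\setminus\mathbb{N}$, $n=[\alpha]+1$ and $T>0$. If $x:(0,\infty)\to\mathbb{R}$ is a non-constant $T$-periodic function of class $C^n$, then its Caputo derivative ${}^{C}D^{\alpha}x$ cannot be a $T$-periodic function.
   Context: $[\alpha]$ denotes the integer part of $\alpha$. A function $x$ on $(0,\infty)$ is $T$-periodic if $x(t+T)=x(t)$ for all $t\in(0,\infty)$. A $T$-periodic function of class $C^n$ on $(0,\infty)$ extends to a function of class $C^n$ on $[0,\infty)$ by setting $x(0)=x(0^+)=x(T)$. For $\alpha\in(0,\infty)\setminus\mathbb{N}$ and $n=[\alpha]+1$, the Caputo fractional-order derivative of order $\alpha$ (with lower limit $0$) of a function $g$ of class $C^n$ is $${}^{C}D^{\alpha}g(t)=\frac{1}{\Gamma(n-\alpha)}\int_0^t (t-s)^{n-\alpha-1}g^{(n)}(s)\,ds .$$ *)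

theory Defs
  imports "HOL-Analysis.Analysis"
begin

(* A function on the half-line (0,\<infinity>) is encoded as a total function on the reals of which
   only the values at positive arguments are used. *)

definition periodic_pos :: "real \<Rightarrow> (real \<Rightarrow> real) \<Rightarrow> bool" where
  "periodic_pos T x \<longleftrightarrow> (\<forall>t>0. x (t + T) = x t)"

(* Class C^n on the open half-line (0,\<infinity>): since the half-line is open, the iterated derivatives
   at t > 0 do not depend on the values of x outside it. *)
definition Cn_pos :: "nat \<Rightarrow> (real \<Rightarrow> real) \<Rightarrow> bool" where
  "Cn_pos n x \<longleftrightarrow>
     (\<forall>k<n. \<forall>t>0. (deriv ^^ k) x field_differentiable (at t)) \<and>
     continuous_on {0<..} ((deriv ^^ n) x)"

(* For 0 \<le> t the library's integral LBINT s=0..t is the Lebesgue integral over the open interval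
   (0,t), so only values at positive arguments enter: the extension of g to the point 0 by
   its right limit, and the value of the kernel at s = t, are immaterial. *)
definition caputo_deriv :: "real \<Rightarrow> (real \<Rightarrow> real) \<Rightarrow> real \<Rightarrow> real" where
  "caputo_deriv \<alpha> g t =
     (let n = nat \<lfloor>\<alpha>\<rfloor> + 1 in
        1 / Gamma (real n - \<alpha>) *
        (LBINT s=0..t. (t - s) powr (real n - \<alpha> - 1) * (deriv ^^ n) g s))"

end

theory Submission
  imports Defs
begin

text \<open>Put \<open>c = n - \<alpha> - 1\<close>, which lies strictly between \<open>-1\<close> and \<open>0\<close>, and let \<open>h\<close> be the \<open>n\<close>-th
  derivative of \<open>x\<close>. If the Caputo derivative were periodic, subtracting its values at \<open>t\<close> and
  \<open>t + T\<close> would give that the integral of \<open>(u - s) powr c * h s\<close> over \<open>s \<in> {0..T}\<close> vanishes for every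
  \<open>u > T\<close>. Differentiating in \<open>u\<close>, the same holds for the exponents \<open>c - k\<close>; at a fixed \<open>u\<close> the
  function \<open>(u - s) powr c * h s\<close> is thus orthogonal to all polynomials in \<open>1 / (u - s)\<close>, and
  Stone-Weierstrass yields \<open>h = 0\<close>. A periodic function whose \<open>n\<close>-th derivative vanishes is
  constant.\<close>

section \<open>Periodicity of derivatives and integrability of the Caputo kernel\<close>

lemma higher_deriv_periodic_pos:
  assumes "periodic_pos T x" and "T > 0"
  shows "periodic_pos T ((deriv ^^ k) x)"
proof (induction k)
  case 0
  show ?case using assms by simp
next
  case (Suc k)
  define f where "f = (deriv ^^ k) x"
  have per: "f (t + T) = f t" if "t > 0" for t
    using Suc that by (auto simp: periodic_pos_def f_def)
  have "deriv f (t + T) = deriv f t" if "t > 0" for t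
  proof -
    \<comment> \<open>\<open>deriv\<close> chooses some \<open>D\<close> satisfying the DERIV
      predicate, and \<open>DERIV_shift\<close> identifies the two predicates, so no
      differentiability of \<open>f\<close> is required.\<close>
    have "deriv f (t + T) = deriv (\<lambda>s. f (s + T)) t"
      unfolding deriv_def DERIV_shift ..
    also have "\<dots> = deriv f t"
    proof (rule deriv_cong_ev)
      show "\<forall>\<^sub>F s in nhds t. f (s + T) = f s"
        by (rule eventually_mono[OF eventually_nhds_in_open[of "{0<..}" t]]) (use that per in auto)
    qed simp
    finally show ?thesis .
  qed
  then show ?case
    by (simp add: periodic_pos_def f_def)
qed

text \<open>For \<open>c > -1\<close> the function \<open>s powr c\<close> is integrable near 0;
  reflection and translation carry this to the singularity at \<open>s = t\<close>. The factor
  \<open>h\<close> is bounded on the compact interval.\<close>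

lemma powr_kernel_absolutely_integrable:
  fixes t c :: real
  assumes c: "c > -1" and t: "t \<ge> 0" and h: "continuous_on {0..t} h"
  shows "set_integrable lborel {0..t} (\<lambda>s. (t - s) powr c * h s)"
proof -
  have "(\<lambda>s. s powr c) integrable_on {0..t}"
    using has_integral_powr_from_0[OF c t] by (auto simp: integrable_on_def)
  then have "(\<lambda>s. s powr c) absolutely_integrable_on {0..t}"
    by (intro nonnegative_absolutely_integrable_1) auto
  then have "(\<lambda>s. (- s) powr c) absolutely_integrable_on {-t..-0}"
    by (subst absolutely_integrable_reflect_real)
  then have "(\<lambda>s. (- s) powr c) absolutely_integrable_on {-t..0}"
    by simp
  then have "(\<lambda>s. (- s) powr c) integrable_on {-t..0}"
    by (rule set_lebesgue_integral_eq_integral(1))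
  then have "(\<lambda>s. (- (s + - t)) powr c) integrable_on {- t - - t..0 - - t}"
    by (subst integrable_shift_real_ivl_iff)
  then have "(\<lambda>s. (t - s) powr c) absolutely_integrable_on {0..t}"
    by (intro nonnegative_absolutely_integrable_1) auto
  moreover have "h \<in> borel_measurable (lebesgue_on {0..t})"
    using h by (intro continuous_imp_measurable_on_sets_lebesgue) auto
  moreover have "bounded (h ` {0..t})"
    using h by (intro compact_imp_bounded compact_continuous_image) auto
  ultimately have "(\<lambda>s. h s * (t - s) powr c) absolutely_integrable_on {0..t}"
    by (intro absolutely_integrable_bounded_measurable_product_real) auto
  then have int: "integrable lebesgue (\<lambda>s. indicator {0..t} s *\<^sub>R ((t - s) powr c * h s))"
    by (simp add: set_integrable_def mult.commute)
  \<comment> \<open>Borel measurability lets integrability pass from \<open>lebesgue\<close> to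
    \<open>lborel\<close>, the measure behind the interval integral in
    \<open>caputo_deriv\<close>.\<close>
  have "(\<lambda>s. indicator {0..t} s *\<^sub>R h s) \<in> borel_measurable borel"
    using h by (intro borel_measurable_continuous_on_indicator) auto
  then have "(\<lambda>s. (t - s) powr c * (indicator {0..t} s *\<^sub>R h s)) \<in> borel_measurable borel"
    by measurable
  then have "(\<lambda>s. indicator {0..t} s *\<^sub>R ((t - s) powr c * h s)) \<in> borel_measurable lborel"
    by (simp add: mult_ac)
  from integrable_completion[OF this] int show ?thesis
    by (simp add: set_integrable_def)
qed

section \<open>Vanishing integrals against powers of \<open>u - s\<close>\<close>

lemma vanishing_powr_integral_step:
  fixes T c :: real
  assumes h: "continuous_on {0..T} h" and c: "c \<noteq> 0"
    and zero: "\<And>u. u > T \<Longrightarrow> integral {0..T} (\<lambda>s. (u - s) powr c * h s) = 0"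
    and u: "u > T"
  shows "integral {0..T} (\<lambda>s. (u - s) powr (c - 1) * h s) = 0"
proof -
  \<comment> \<open>Differentiation under the integral sign is legitimate because
    \<open>u > T\<close> keeps \<open>u - s\<close> positive on \<open>{0..T}\<close>, away from the
    singularity.\<close>
  have "((\<lambda>u. integral (cbox 0 T) (\<lambda>s. (u - s) powr c * h s)) has_field_derivative
      integral (cbox 0 T) (\<lambda>s. c * (u - s) powr (c - 1) * h s)) (at u within {T<..})"
  proof (rule leibniz_rule_field_derivative)
    fix v s assume "v \<in> {T<..}" "s \<in> cbox 0 T"
    then show "((\<lambda>v. (v - s) powr c * h s) has_field_derivative
        c * (v - s) powr (c - 1) * h s) (at v within {T<..})"
      by (auto intro!: derivative_eq_intros)
  next
    fix v assume "v \<in> {T<..}"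
    then show "(\<lambda>s. (v - s) powr c * h s) integrable_on cbox 0 T"
      using h by (auto intro!: integrable_continuous_real continuous_intros)
  next
    show "continuous_on ({T<..} \<times> cbox 0 T) (\<lambda>(v, s). c * (v - s) powr (c - 1) * h s)"
      unfolding case_prod_unfold
      by (intro continuous_intros continuous_on_compose2[OF h]) auto
  qed (use u in auto)
  then have "((\<lambda>u. integral {0..T} (\<lambda>s. (u - s) powr c * h s)) has_field_derivative
      integral {0..T} (\<lambda>s. c * (u - s) powr (c - 1) * h s)) (at u)"
    using u by (simp add: at_within_open[of u "{T<..}"])
  moreover have "((\<lambda>u. integral {0..T} (\<lambda>s. (u - s) powr c * h s)) has_field_derivative 0) (at u)"
  proof (rule has_field_derivative_transform_within_open[of "\<lambda>_. 0"])
    show "((\<lambda>_. 0::real) has_field_derivative 0) (at u)" by simp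
  qed (use u zero in \<open>auto intro!: open_greaterThan\<close>)
  ultimately have "integral {0..T} (\<lambda>s. c * (u - s) powr (c - 1) * h s) = 0"
    by (rule DERIV_unique)
  then show ?thesis
    using c by (simp add: mult.assoc)
qed

text \<open>As \<open>c\<close> is not natural, no factor \<open>c - k\<close> produced by repeated
  differentiation vanishes. For natural \<open>c\<close> the integral would be a polynomial in
  \<open>u\<close>, and its vanishing would control only finitely many moments of
  \<open>h\<close>.\<close>

lemma vanishing_powr_integral_imp_zero:
  fixes T c :: real
  assumes T: "T > 0" and h: "continuous_on {0..T} h" and c: "c \<notin> \<nat>"
    and zero: "\<And>u. u > T \<Longrightarrow> integral {0..T} (\<lambda>s. (u - s) powr c * h s) = 0"
    and s: "s \<in> {0..T}"
  shows "h s = 0"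
proof -
  have F0: "integral {0..T} (\<lambda>s. (u - s) powr (c - real k) * h s) = 0" if "u > T" for k u
    using that
  proof (induction k arbitrary: u)
    case 0
    then show ?case using zero by simp
  next
    case (Suc k)
    have "c - real k \<noteq> 0"
      using c by (metis eq_iff_diff_eq_0 of_nat_in_Nats)
    from vanishing_powr_integral_step[OF h this Suc.IH Suc.prems] show ?case
      by (simp add: algebra_simps)
  qed
  \<comment> \<open>Any fixed number above \<open>T\<close> would serve.\<close>
  define u where "u = T + 1"
  have u: "u > T" by (simp add: u_def)
  have pos: "u - s > 0" if "s \<in> {0..T}" for s using that u by auto
  have cont: "continuous_on {0..T} (\<lambda>s. poly p (1 / (u - s)))" for p
    using pos by (intro continuous_intros) force
  have cont_powr: "continuous_on {0..T} (\<lambda>s. (u - s) powr a)" for a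
    using pos by (intro continuous_intros) force
  \<comment> \<open>The exponent shift \<open>k\<close> stays general because each
    \<open>pCons\<close> absorbs a factor \<open>1 / (u - s)\<close> into the power, raising
    \<open>k\<close> by one.\<close>
  have P0: "integral {0..T} (\<lambda>s. poly p (1 / (u - s)) * ((u - s) powr (c - real k) * h s)) = 0" for p k
  proof (induction p arbitrary: k)
    case 0
    then show ?case by simp
  next
    case (pCons a p)
    have "integral {0..T} (\<lambda>s. poly (pCons a p) (1 / (u - s)) * ((u - s) powr (c - real k) * h s)) =
        integral {0..T} (\<lambda>s. a * ((u - s) powr (c - real k) * h s) +
          poly p (1 / (u - s)) * ((u - s) powr (c - real (Suc k)) * h s))"
    proof (rule integral_cong)
      fix s assume "s \<in> {0..T}"
      then have "(u - s) powr (c - real (Suc k)) = (u - s) powr (c - real k) / (u - s)"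
        using pos[of s] powr_diff[of "u - s" "c - real k" 1]
        by (simp add: algebra_simps)
      then show "poly (pCons a p) (1 / (u - s)) * ((u - s) powr (c - real k) * h s) =
          a * ((u - s) powr (c - real k) * h s) +
          poly p (1 / (u - s)) * ((u - s) powr (c - real (Suc k)) * h s)"
        by (simp add: algebra_simps)
    qed
    also have "\<dots> = integral {0..T} (\<lambda>s. a * ((u - s) powr (c - real k) * h s)) +
        integral {0..T} (\<lambda>s. poly p (1 / (u - s)) * ((u - s) powr (c - real (Suc k)) * h s))"
      by (intro integral_add integrable_continuous_real continuous_on_mult cont cont_powr h
          continuous_on_const)
    also have "\<dots> = 0"
      using F0[OF u, of k] pCons.IH[of "Suc k"] by simp
    finally show ?case .
  qed
  \<comment> \<open>The polynomials in \<open>1 / (u - s)\<close> form an algebra that separates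
    points, since \<open>1 / (u - s)\<close> is injective in \<open>s\<close> on
    \<open>{0..T}\<close>.\<close>
  define R where "R = range (\<lambda>p s. poly p (1 / (u - s)))"
  interpret function_ring_on R "{0..T}"
  proof
    fix f g assume "f \<in> R" "g \<in> R"
    then obtain p q where fg: "f = (\<lambda>s. poly p (1 / (u - s)))" "g = (\<lambda>s. poly q (1 / (u - s)))"
      by (auto simp: R_def)
    show "(\<lambda>s. f s + g s) \<in> R"
      unfolding R_def fg by (rule image_eqI[of _ _ "p + q"]) auto
    show "(\<lambda>s. f s * g s) \<in> R"
      unfolding R_def fg by (rule image_eqI[of _ _ "p * q"]) auto
  next
    fix a :: real
    show "(\<lambda>_. a) \<in> R"
      unfolding R_def by (rule image_eqI[of _ _ "[:a:]"]) auto
  next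
    fix a b assume ab: "a \<in> {0..T}" "b \<in> {0..T}" "a \<noteq> b"
    show "\<exists>f\<in>R. f a \<noteq> f b"
    proof
      show "(\<lambda>s. poly [:0, 1:] (1 / (u - s))) \<in> R"
        unfolding R_def by (rule rangeI)
      show "poly [:0, 1:] (1 / (u - a)) \<noteq> poly [:0, 1:] (1 / (u - b))"
        using ab pos[of a] pos[of b] by simp
    qed
  next
    show "continuous_on {0..T} f" if "f \<in> R" for f
      using that cont by (auto simp: R_def)
  qed simp
  define w where "w = (\<lambda>s. (u - s) powr c)"
  have cw: "continuous_on {0..T} w" unfolding w_def by (rule cont_powr)
  define M where "M = integral {0..T} (\<lambda>s. w s * \<bar>h s\<bar>)"
  define I where "I = integral {0..T} (\<lambda>s. w s * (h s)\<^sup>2)"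
  \<comment> \<open>\<open>I\<close> is a weighted squared L2 norm of \<open>h\<close>. If
    \<open>g\<close> in \<open>R\<close> is within \<open>e\<close> of \<open>h\<close>, then
    \<open>P0\<close> makes \<open>w * h\<close> orthogonal to \<open>g\<close>, so \<open>I\<close>
    is the integral of \<open>w * h * (h - g)\<close>.\<close>
  have bound: "I \<le> e * M" if e: "e > 0" for e
  proof -
    obtain g where "g \<in> R" and g: "\<And>s. s \<in> {0..T} \<Longrightarrow> \<bar>h s - g s\<bar> < e"
      using Stone_Weierstrass_basic[OF h e] by blast
    then obtain p where p: "g = (\<lambda>s. poly p (1 / (u - s)))" by (auto simp: R_def)
    have cg: "continuous_on {0..T} g" unfolding p by (rule cont)
    have "I = I - integral {0..T} (\<lambda>s. g s * (w s * h s))"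
      using P0[of p 0] by (simp add: p w_def)
    also have "\<dots> = integral {0..T} (\<lambda>s. w s * (h s)\<^sup>2 - g s * (w s * h s))"
      unfolding I_def
      by (intro integral_diff[symmetric] integrable_continuous_real continuous_intros cw h cg)
    also have "\<dots> \<le> integral {0..T} (\<lambda>s. e * (w s * \<bar>h s\<bar>))"
    proof (rule integral_le)
      fix s assume s: "s \<in> {0..T}"
      have "w s * (h s)\<^sup>2 - g s * (w s * h s) = w s * (h s * (h s - g s))"
        by (simp add: power2_eq_square algebra_simps)
      also have "\<dots> \<le> w s * (\<bar>h s\<bar> * e)"
      proof (rule mult_left_mono)
        have "h s * (h s - g s) \<le> \<bar>h s\<bar> * \<bar>h s - g s\<bar>"
          by (metis abs_ge_self abs_mult)
        also have "\<dots> \<le> \<bar>h s\<bar> * e"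
          using g[OF s] by (intro mult_left_mono) auto
        finally show "h s * (h s - g s) \<le> \<bar>h s\<bar> * e" .
      qed (simp add: w_def)
      finally show "w s * (h s)\<^sup>2 - g s * (w s * h s) \<le> e * (w s * \<bar>h s\<bar>)"
        by (simp add: mult_ac)
    qed (intro integrable_continuous_real continuous_intros cw h cg)+
    also have "\<dots> = e * M" by (simp add: M_def)
    finally show ?thesis .
  qed
  have "I \<le> 0"
  proof (rule ccontr)
    assume "\<not> I \<le> 0"
    moreover from this bound[of 1] have "M > 0" by simp
    \<comment> \<open>The choice \<open>e = I / (2 * M)\<close> would give
      \<open>I \<le> I / 2\<close>.\<close>
    ultimately show False
      using bound[of "I / (2 * M)"] by simp
  qed
  moreover have "I \<ge> 0"
    unfolding I_def by (rule integral_nonneg)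
      (auto simp: w_def intro!: integrable_continuous_real continuous_on_mult cont_powr
        continuous_on_power h)
  ultimately have "I = 0" by simp
  then have "w s * (h s)\<^sup>2 = 0"
    unfolding I_def
    by (subst (asm) integral_eq_0_iff) (use T s in \<open>auto simp: w_def
        intro!: continuous_on_mult cont_powr continuous_on_power h\<close>)
  then show ?thesis
    using pos[OF s] by (simp add: w_def)
qed

section \<open>Caputo derivatives of periodic functions\<close>

lemma caputo_deriv_eq_integral:
  fixes \<alpha> t :: real
  assumes n: "n = nat \<lfloor>\<alpha>\<rfloor> + 1" and "\<alpha> < real n" and t: "t \<ge> 0"
    and h: "continuous_on {0..t} h" and eq: "\<And>s. s > 0 \<Longrightarrow> (deriv ^^ n) x s = h s"
  shows "caputo_deriv \<alpha> x t =
    1 / Gamma (real n - \<alpha>) * integral {0..t} (\<lambda>s. (t - s) powr (real n - \<alpha> - 1) * h s)"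
proof -
  \<comment> \<open>The interval integral sees only the open interval, so the uncontrolled value of
    \<open>(deriv ^^ n) x\<close> at 0 may be replaced by that of \<open>h\<close>.\<close>
  have "(LBINT s=0..t. (t - s) powr (real n - \<alpha> - 1) * (deriv ^^ n) x s) =
      (LBINT s=0..t. (t - s) powr (real n - \<alpha> - 1) * h s)"
    using t by (intro interval_integral_cong) (auto simp: einterval_def min_def eq)
  also have "\<dots> = integral {0..t} (\<lambda>s. (t - s) powr (real n - \<alpha> - 1) * h s)"
    using interval_integral_eq_integral[OF t powr_kernel_absolutely_integrable[OF _ t h]] assms(2)
    by (simp add: zero_ereal_def)
  finally show ?thesis
    unfolding caputo_deriv_def Let_def n[symmetric] by (rule arg_cong)
qed

text \<open>Descent on the order: a constant derivative of a periodic function is zero, since the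
  mean value theorem over one period gives \<open>T * c = 0\<close>. The descent ends at the first
  derivative.\<close>

lemma periodic_higher_deriv_zero_imp_constant:
  assumes T: "T > 0" and per: "periodic_pos T x" and Cn: "Cn_pos n x" and n: "n > 0"
    and zero: "\<And>t. t > 0 \<Longrightarrow> (deriv ^^ n) x t = 0"
  shows "x constant_on {0<..}"
proof -
  have DER: "((deriv ^^ k) x has_field_derivative (deriv ^^ Suc k) x t) (at t)"
    if "k < n" "t > 0" for k t
    using Cn that by (simp add: Cn_pos_def DERIV_deriv_iff_field_differentiable)
  have const: "\<exists>c. \<forall>t\<in>{0<..}. (deriv ^^ k) x t = c"
    if k: "k < n" and z: "\<And>t. t > 0 \<Longrightarrow> (deriv ^^ Suc k) x t = 0" for k
  proof (rule has_field_derivative_zero_constant)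
    show "((deriv ^^ k) x has_field_derivative 0) (at t within {0<..})" if "t \<in> {0<..}" for t
      using DER[of k t] k z[of t] that by (auto intro: has_field_derivative_at_within)
  qed simp
  have step: "(deriv ^^ Suc k) x t = 0"
    if k: "Suc k < n" and z: "\<And>t. t > 0 \<Longrightarrow> (deriv ^^ Suc (Suc k)) x t = 0" and "t > 0" for k t
  proof -
    obtain c where c: "\<And>t. t > 0 \<Longrightarrow> (deriv ^^ Suc k) x t = c"
      using const[OF k z] by auto
    \<comment> \<open>The period from \<open>T\<close> to \<open>T + T\<close> is used because
      nothing is known about \<open>x\<close> at 0.\<close>
    have "\<exists>z>T. z < T + T \<and> (deriv ^^ k) x (T + T) - (deriv ^^ k) x T =
        (T + T - T) * (deriv ^^ Suc k) x z"
      using T k by (intro MVT2 DER) auto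
    then obtain z where "z > T"
      "(deriv ^^ k) x (T + T) - (deriv ^^ k) x T = T * (deriv ^^ Suc k) x z"
      by auto
    moreover have "(deriv ^^ k) x (T + T) = (deriv ^^ k) x T"
      using higher_deriv_periodic_pos[OF per T, of k] T unfolding periodic_pos_def by blast
    ultimately have "c = 0"
      using T c[of z] by simp
    then show ?thesis using c that by simp
  qed
  obtain m where m: "n = Suc m" using n by (cases n) auto
  \<comment> \<open>Downward induction on the order, run upward in \<open>j\<close>; truncated
    subtraction makes the claim stationary beyond \<open>j = m\<close>, which is the first
    derivative.\<close>
  have "(deriv ^^ Suc (m - j)) x t = 0" if "t > 0" for j t
    using that
  proof (induction j arbitrary: t)
    case 0
    then show ?case using zero m by simp
  next
    case (Suc j)
    show ?case
    proof (cases "j < m")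
      case True
      then have "m - j = Suc (m - Suc j)" by simp
      with step[of "m - Suc j" t] Suc True m show ?thesis by simp
    next
      case False
      then have "m - Suc j = m - j" by simp
      with Suc show ?thesis by simp
    qed
  qed
  from this[of _ m] const[of 0] n show ?thesis
    by (auto simp: constant_on_def)
qed

theorem theorem2:
  fixes \<alpha> T :: real and n :: nat and x :: "real \<Rightarrow> real"
  assumes "\<alpha> > 0" and "\<alpha> \<notin> \<nat>"
    and "n = nat \<lfloor>\<alpha>\<rfloor> + 1"
    and "T > 0"
    and "Cn_pos n x"
    and "periodic_pos T x"
    and "\<not> x constant_on {0<..}"
  shows "\<not> periodic_pos T (caputo_deriv \<alpha> x)"
proof
  assume per: "periodic_pos T (caputo_deriv \<alpha> x)"
  note n = assms(3) and T = assms(4)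
  define c where "c = real n - \<alpha> - 1"
  have c: "c \<notin> \<nat>" "c > -1" "\<alpha> < real n"
  proof -
    have "real n = of_int \<lfloor>\<alpha>\<rfloor> + 1" using n assms(1) by simp
    \<comment> \<open>Non-integrality of \<open>\<alpha>\<close> enters here: it makes
      \<open>c\<close> strictly negative and strictly greater than -1.\<close>
    moreover have "of_int \<lfloor>\<alpha>\<rfloor> \<noteq> \<alpha>"
      using assms(1,2) by (metis floor_of_int less_eq_real_def of_int_0_le_iff of_nat_in_Nats
          of_nat_nat zero_le_floor)
    ultimately have "c < 0" "c > -1"
      unfolding c_def by linarith+
    then show "c \<notin> \<nat>" "c > -1" "\<alpha> < real n" by (auto simp: c_def Nats_def)
  qed
  \<comment> \<open>Shifting the argument by one period extends the \<open>n\<close>-th derivative continuously to \<open>0\<close>.\<close>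
  define h where "h = (\<lambda>s. (deriv ^^ n) x (s + T))"
  have per_n: "(deriv ^^ n) x (s + T) = (deriv ^^ n) x s" if "s > 0" for s
    using higher_deriv_periodic_pos[OF assms(6) T] that by (simp add: periodic_pos_def)
  have h_eq: "(deriv ^^ n) x s = h s" if "s > 0" for s
    using per_n[OF that] by (simp add: h_def)
  \<comment> \<open>Valid also at \<open>s = 0\<close>, since \<open>h\<close> evaluates the
    derivative at \<open>s + T > 0\<close>; the closed integration intervals below include that
    endpoint.\<close>
  have h_per: "h (s + T) = h s" if "s \<ge> 0" for s
    using per_n[of "s + T"] that T by (simp add: h_def)
  have h: "continuous_on {0..t} h" for t
    unfolding h_def using assms(5) T
    by (auto simp: Cn_pos_def intro!: continuous_on_compose2[of "{0<..}" "(deriv ^^ n) x"]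
        continuous_intros)
  define J where "J = (\<lambda>t. integral {0..t} (\<lambda>s. (t - s) powr c * h s))"
  have caputo: "caputo_deriv \<alpha> x t = 1 / Gamma (real n - \<alpha>) * J t" if "t \<ge> 0" for t
    using caputo_deriv_eq_integral[OF n c(3) that h h_eq] by (simp add: J_def c_def)
  \<comment> \<open>A nonzero prefactor can be cancelled, so \<open>J\<close> inherits the assumed
    periodicity.\<close>
  have "Gamma (real n - \<alpha>) > 0"
    using c by (intro Gamma_real_pos) simp
  then have J_per: "J (t + T) = J t" if "t > 0" for t
    using per that T by (simp add: periodic_pos_def caputo)
  have "integral {0..T} (\<lambda>s. (u - s) powr c * h s) = 0" if "u > T" for u
  proof -
    define t where "t = u - T"
    have t: "t > 0" "u = t + T" using that by (auto simp: t_def)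
    have "set_integrable lborel {0..u} (\<lambda>s. (u - s) powr c * h s)"
      using t T by (intro powr_kernel_absolutely_integrable c h) auto
    then have "(\<lambda>s. (u - s) powr c * h s) integrable_on {0..u}"
      by (rule set_borel_integral_eq_integral)
    \<comment> \<open>Split at \<open>T\<close>: shifting by one period turns the part over
      \<open>{T..u}\<close> into \<open>J t\<close>, which equals \<open>J u\<close>, so the part
      over \<open>{0..T}\<close> must vanish.\<close>
    then have "J u = integral {0..T} (\<lambda>s. (u - s) powr c * h s) +
        integral {T..u} (\<lambda>s. (u - s) powr c * h s)"
      unfolding J_def using t T
      by (subst Henstock_Kurzweil_Integration.integral_combine[where c = T]) auto
    also have "integral {T..u} (\<lambda>s. (u - s) powr c * h s) =
        integral {T - T..u - T} (\<lambda>s. (u - (s + T)) powr c * h (s + T))"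
      by (rule integral_shift_real_ivl[symmetric])
    also have "\<dots> = J t"
      unfolding J_def using t(2) by (auto intro!: integral_cong simp: h_per)
    finally show ?thesis
      using J_per t by simp
  qed
  then have h0: "h s = 0" if "s \<in> {0..T}" for s
    using vanishing_powr_integral_imp_zero[OF T h c(1) _ that] by blast
  have hnT: "h (s + real k * T) = h s" if "s \<ge> 0" for s k
  proof (induction k)
    case (Suc k)
    then show ?case
      using h_per[of "s + real k * T"] that T by (simp add: algebra_simps)
  qed simp
  have "h s = 0" if "s > 0" for s
  proof -
    define k where "k = nat \<lfloor>s / T\<rfloor>"
    have k: "real k \<le> s / T" "s / T < real k + 1"
      using that T by (auto simp: k_def)
    then have "s - real k * T \<in> {0..T}"
      using T by (simp add: field_simps)
    with hnT[of "s - real k * T" k] h0 show ?thesis by simp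
  qed
  then have "x constant_on {0<..}"
    using n h_eq by (intro periodic_higher_deriv_zero_imp_constant[OF T assms(6,5)]) simp_all
  then show False using assms(7) by simp
qed

end
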